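(* Let $\Sigma$ be the signature of the shallow encoding of the pure $\lambda$-calculus given in the context. If $s,t$ are $\lambda$-terms such that $s$ $\beta$-contracts to $t$, i.e. $s\equiv(\lambda x_i.s_1)s_2$ and $t\equiv s_1[x_i:=s_2]$, then, in the context declaring $a_j:\Lambda$ for each free variable $x_j$ of $s$, $$\vdash_\Sigma\ \beta\big(\ll a_i:\Lambda\gg\mathtt{enc}(s_1),\ \mathtt{enc}(s_2)\big)\ :\ \triangleright\Big(@\big(\lambda(\ll a_i:\Lambda\gg\mathtt{enc}(s_1)),\ \mathtt{enc}(s_2)\big),\ (\ll a_i:\Lambda\gg\mathtt{enc}(s_1))[\mathtt{enc}(s_2)]\Big).$$
   Context: **$\lambda$-calculus.** Pure $\lambda$-terms over variables $x_1,x_2,\dots$ (variables, applications, abstractions $\lambda x_i.s$), with $\equiv$ identity up to $\alpha$-conversion and $s[x:=r]$ capture-avoiding substitution. **Framework syntax.** Countably infinitely many atoms $a,b,c,\dots$ and parameters $X,\dots$. Sorts $\gamma::=\mathcal{F}\,\overline t\mid\ \ll a:\mathcal{F}\,\overline t\gg\gamma$, with $\mathcal{F}$ a sort constructor; terms $t::=a\mid X\overline{[t]}\mid f\,\overline t\mid\ \ll a:\mathcal{F}\,\overline t\gg t$, with $f$ a term constructor and $X\overline{[t]}$ a parameter with suspended concretions; ground means parameter-free. A permutation of atoms acts by renaming all atoms (including abstracted ones); $(a\ b)$ is a swapping. Freshness: $a\mathrel\# b$ for $a\ne b$; $a\mathrel\#\mathcal{F}\,\overline t$, $a\mathrel\#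 f\,\overline t$, $a\mathrel\# X\overline{[t]}$ if $a\mathrel\# t_i$ for all $i$; $a\mathrel\#\ll a:\mathcal{F}\,\overline t\gg M$ if $a\mathrel\#\mathcal{F}\,\overline t$; $a\mathrel\#\ll b:\mathcal{F}\,\overline t\gg M$ ($b\ne a$) if $a\mathrel\#\mathcal{F}\,\overline t$ and $a\mathrel\# M$. $\approx_\alpha$ on ground expressions: $a\approx_\alpha a$; componentwise for $\mathcal{F}\,\overline t$ and $f\,\overline t$; $\ll a:\mathcal{F}\,\overline t\gg M\approx_\alpha\ \ll a:\mathcal{F}\,\overline u\gg M'$ if $\mathcal{F}\,\overline t\approx_\alpha\mathcal{F}\,\overline u$ and $M\approx_\alpha M'$; $\ll a:\mathcal{F}\,\overline t\gg M\approx_\alpha\ \ll b:\mathcal{F}\,\overline u\gg M'$ ($a\neq b$) if $\mathcal{F}\,\overline t\approx_\alpha\mathcal{F}\,\overline u$, $M\approx_\alpha(a\ b)\cdot M'$ and $a\mathrel\# M'$. Atom substitution $M[a\mapsto t]$: $a\mapsto t$; $b\mapsto b$; componentwise on $f$, $\mathcal{F}$ and concretion arguments; $(\ll a:\mathcal{F}\,\overline s\gg M)[a\mapsto t]=\ \ll a:\mathcal{F}\,\overline{s[a\mapsto t]}\gg M$; $(\ll b:\mathcal{F}\,\overline s\gg M)[a\mapsto t]=\ \ll c:\mathcal{F}\,\overline{s[a\mapsto t]}\gg(((b\ c)\cdot M)[a\mapsto t])$ for $b\ne a$, with $c\ne a,b$ chosen with $c\mathrel\# M$, $c\mathrel\#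 t$. Concretion: $(\ll a:\mathcal{F}\,\overline s\gg u)[t]=u[a\mapsto t]$. **Signature $\Sigma$** (all freshness contexts empty; "$\_$" is an unused name). Sort constructors: $\Lambda:\mathsf{data}$; $\triangleright:(\_:\Lambda,\_:\Lambda)\to\mathsf{data}$. Term constructors: $@:(\_:\Lambda,\_:\Lambda)\to\Lambda$; $\lambda:(\_:\ \ll\_:\Lambda\gg\Lambda)\to\Lambda$; $\beta:(B:\ \ll\_:\Lambda\gg\Lambda,\ N:\Lambda)\to\triangleright(@(\lambda(B),N),\,B[N])$, where $B,N$ are parameters. **Sorting of ground terms.** A context $\Gamma$ is a sequence of declarations of distinct atoms with data sorts. $\Gamma\vdash_\Sigma t:\gamma$ (with empty parameter telescope) is generated, over this signature, by: $\Gamma\vdash_\Sigma a:\Gamma(a)$ for $a\in\mathrm{dom}(\Gamma)$; if $f:(X_1:\gamma_1,\dots,X_n:\gamma_n)\to\mathcal{F}\,\overline u$ is in $\Sigma$ and, for each $i$, $\Gamma\vdash_\Sigma t_i:\gamma_i$ with $\gamma_i$ instantiated on the preceding $t_j$'s (bound atoms of the declaration being renamed to new ones to avoid collisions), then $\Gamma\vdash_\Sigma f(t_1,\dots,t_n):\mathcal{F}\,\overline u'$, where $\overline u'$ is $\overline u$ with each $X_i$ instantiated by $t_i$ and the suspended concretions performed; if $\mathcal{F}\,\overline s$ is a well-formed sort under $\Gamma$ and $\Gamma,b:\mathcal{F}\,\overline s\vdash_\Sigma(a\ b)\cdot t:(a\ b)\cdot\gamma$ with $b\notin\mathrm{dom}(\Gamma)$,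 $b\mathrel\# t$, $b\mathrel\#\gamma$, then $\Gamma\vdash_\Sigma\ \ll a:\mathcal{F}\,\overline s\gg t:\ \ll a:\mathcal{F}\,\overline s\gg\gamma$; if $\Gamma\vdash_\Sigma t:\gamma$ and $\gamma\approx_\alpha\gamma'$ then $\Gamma\vdash_\Sigma t:\gamma'$. (A data sort $\mathcal{F}\,\overline s$ is well-formed under $\Gamma$ when its arguments have the declared sorts.) **Encoding.** Each variable $x_i$ is encoded as a distinct atom $a_i$: $\mathtt{enc}(x_i)=a_i$; $\mathtt{enc}(r_1r_2)=@(\mathtt{enc}(r_1),\mathtt{enc}(r_2))$; $\mathtt{enc}(\lambda x_i.r)=\lambda(\ll a_i:\Lambda\gg\mathtt{enc}(r))$. *)

theory Defs
  imports "HOL-Combinatorics.Transposition"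
begin

section \<open>The untyped lambda calculus\<close>

datatype lam = Var nat | Ap lam lam | Lm nat lam

primrec FV :: "lam \<Rightarrow> nat set" where
  "FV (Var x) = {x}"
| "FV (Ap r s) = FV r \<union> FV s"
| "FV (Lm x r) = FV r - {x}"

primrec lperm :: "(nat \<Rightarrow> nat) \<Rightarrow> lam \<Rightarrow> lam" where
  "lperm p (Var x) = Var (p x)"
| "lperm p (Ap r s) = Ap (lperm p r) (lperm p s)"
| "lperm p (Lm x r) = Lm (p x) (lperm p r)"

lemma size_lperm [simp]: "size (lperm p r) = size r"
  by (induction r) simp_all

text \<open>
  Capture-avoiding substitution: \<open>lsubst s x r\<close> is \<open>s[x := r]\<close>.  A bound variable that would
  capture is renamed by a swapping with a new variable; swapping instead of substituting the new
  variable only makes termination immediate.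
\<close>

function lsubst :: "lam \<Rightarrow> nat \<Rightarrow> lam \<Rightarrow> lam" where
  "lsubst (Var y) x r = (if y = x then r else Var y)"
| "lsubst (Ap s t) x r = Ap (lsubst s x r) (lsubst t x r)"
| "lsubst (Lm y s) x r =
    (if y = x then Lm y s
     else if y \<notin> FV r then Lm y (lsubst s x r)
     else let z = (SOME z. z \<noteq> x \<and> z \<noteq> y \<and> z \<notin> FV s \<and> z \<notin> FV r)
          in Lm z (lsubst (lperm (transpose y z) s) x r))"
  by pat_completeness auto
termination by (relation "measure (\<lambda>(s, x, r). size s)") auto

inductive lalpha :: "lam \<Rightarrow> lam \<Rightarrow> bool" (infix "\<equiv>\<^sub>\<alpha>" 50) where
  refl: "s \<equiv>\<^sub>\<alpha> s"
| sym: "s \<equiv>\<^sub>\<alpha> t \<Longrightarrow> t \<equiv>\<^sub>\<alpha> s"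
| trans: "s \<equiv>\<^sub>\<alpha> t \<Longrightarrow> t \<equiv>\<^sub>\<alpha> r \<Longrightarrow> s \<equiv>\<^sub>\<alpha> r"
| app: "s \<equiv>\<^sub>\<alpha> s' \<Longrightarrow> t \<equiv>\<^sub>\<alpha> t' \<Longrightarrow> Ap s t \<equiv>\<^sub>\<alpha> Ap s' t'"
| lam: "s \<equiv>\<^sub>\<alpha> s' \<Longrightarrow> Lm x s \<equiv>\<^sub>\<alpha> Lm x s'"
| rename: "y \<notin> FV s \<Longrightarrow> Lm x s \<equiv>\<^sub>\<alpha> Lm y (lsubst s x (Var y))"


section \<open>Expressions of the framework\<close>

datatype atom = Atom nat

type_synonym param = string

text \<open>
  \<open>'s\<close> and \<open>'f\<close> are the types of sort and term constructors.  \<open>Par X us\<close> is the parameter \<open>X\<close> with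
  the suspended concretions \<open>us\<close>; \<open>Abs a F ss t\<close> is the abstraction of \<open>a\<close>, of data sort \<open>F ss\<close>,
  in \<open>t\<close>.
\<close>

datatype ('s, 'f) trm =
    At atom
  | Par param "('s, 'f) trm list"
  | Con 'f "('s, 'f) trm list"
  | Abs atom 's "('s, 'f) trm list" "('s, 'f) trm"

datatype ('s, 'f) srt =
    Data 's "('s, 'f) trm list"
  | SAbs atom 's "('s, 'f) trm list" "('s, 'f) srt"

fun perm :: "(atom \<Rightarrow> atom) \<Rightarrow> ('s, 'f) trm \<Rightarrow> ('s, 'f) trm" where
  "perm p (At a) = At (p a)"
| "perm p (Par X us) = Par X (map (perm p) us)"
| "perm p (Con f ts) = Con f (map (perm p) ts)"
| "perm p (Abs a F ss t) = Abs (p a) F (map (perm p) ss) (perm p t)"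

fun perm_srt :: "(atom \<Rightarrow> atom) \<Rightarrow> ('s, 'f) srt \<Rightarrow> ('s, 'f) srt" where
  "perm_srt p (Data F ts) = Data F (map (perm p) ts)"
| "perm_srt p (SAbs a F ss g) = SAbs (p a) F (map (perm p) ss) (perm_srt p g)"

fun fresh :: "atom \<Rightarrow> ('s, 'f) trm \<Rightarrow> bool" where
  "fresh a (At b) \<longleftrightarrow> a \<noteq> b"
| "fresh a (Par X us) \<longleftrightarrow> (\<forall>u \<in> set us. fresh a u)"
| "fresh a (Con f ts) \<longleftrightarrow> (\<forall>t \<in> set ts. fresh a t)"
| "fresh a (Abs b F ss t) \<longleftrightarrow> (\<forall>s \<in> set ss. fresh a s) \<and> (a = b \<or> fresh a t)"

fun fresh_srt :: "atom \<Rightarrow> ('s, 'f) srt \<Rightarrow> bool" where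
  "fresh_srt a (Data F ts) \<longleftrightarrow> (\<forall>t \<in> set ts. fresh a t)"
| "fresh_srt a (SAbs b F ss g) \<longleftrightarrow> (\<forall>s \<in> set ss. fresh a s) \<and> (a = b \<or> fresh_srt a g)"

text \<open>Alpha-equivalence relates ground expressions only, so there is no rule for parameters.\<close>

inductive aeq :: "('s, 'f) trm \<Rightarrow> ('s, 'f) trm \<Rightarrow> bool" where
  aeq_At: "aeq (At a) (At a)"
| aeq_Con: "list_all2 aeq ts us \<Longrightarrow> aeq (Con f ts) (Con f us)"
| aeq_Abs_same: "list_all2 aeq ts us \<Longrightarrow> aeq t t' \<Longrightarrow> aeq (Abs a F ts t) (Abs a F us t')"
| aeq_Abs_diff: "a \<noteq> b \<Longrightarrow> list_all2 aeq ts us \<Longrightarrow> aeq t (perm (transpose a b) t') \<Longrightarrow> fresh a t'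
    \<Longrightarrow> aeq (Abs a F ts t) (Abs b F us t')"

inductive aeq_srt :: "('s, 'f) srt \<Rightarrow> ('s, 'f) srt \<Rightarrow> bool" where
  aeq_Data: "list_all2 aeq ts us \<Longrightarrow> aeq_srt (Data F ts) (Data F us)"
| aeq_SAbs_same: "list_all2 aeq ts us \<Longrightarrow> aeq_srt g g' \<Longrightarrow> aeq_srt (SAbs a F ts g) (SAbs a F us g')"
| aeq_SAbs_diff: "a \<noteq> b \<Longrightarrow> list_all2 aeq ts us \<Longrightarrow> aeq_srt g (perm_srt (transpose a b) g')
    \<Longrightarrow> fresh_srt a g' \<Longrightarrow> aeq_srt (SAbs a F ts g) (SAbs b F us g')"

lemma size_perm [simp]: "size (perm p t) = size t"
proof (induction p t rule: perm.induct)
  case (2 p X us)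
  have "size_list size (map (perm p) us) = size_list size us"
    using 2 by (induction us) auto
  then show ?case by simp
next
  case (3 p f ts)
  have "size_list size (map (perm p) ts) = size_list size ts"
    using 3 by (induction ts) auto
  then show ?case by simp
next
  case (4 p a F ss t)
  have "size_list size (map (perm p) ss) = size_list size ss"
    using 4(1) by (induction ss) auto
  then show ?case using 4(2) by simp
qed simp

lemma size_perm_srt [simp]: "size (perm_srt p g) = size g"
  by (induction p g rule: perm_srt.induct) (auto simp: comp_def)


section \<open>Atom substitution, concretion and instantiation\<close>

text \<open>\<open>subst t a u\<close> is \<open>t[a \<mapsto> u]\<close>.\<close>

function subst :: "('s, 'f) trm \<Rightarrow> atom \<Rightarrow> ('s, 'f) trm \<Rightarrow> ('s, 'f) trm" where
  "subst (At b) a u = (if b = a then u else At b)"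
| "subst (Par X ts) a u = Par X (map (\<lambda>t. subst t a u) ts)"
| "subst (Con f ts) a u = Con f (map (\<lambda>t. subst t a u) ts)"
| "subst (Abs b F ss t) a u =
    (if b = a then Abs b F (map (\<lambda>s. subst s a u) ss) t
     else let c = (SOME c. c \<noteq> a \<and> c \<noteq> b \<and> fresh c t \<and> fresh c u)
          in Abs c F (map (\<lambda>s. subst s a u) ss) (subst (perm (transpose b c) t) a u))"
  by pat_completeness auto
termination
  by (relation "measure (\<lambda>(t, a, u). size t)")
     (auto simp: less_Suc_eq_le dest: size_list_estimation'[OF _ order_refl, where f = size])

text \<open>
  Only abstractions can be concreted; the value on other terms is left unspecified.
\<close>

fun conc :: "('s, 'f) trm \<Rightarrow> ('s, 'f) trm \<Rightarrow> ('s, 'f) trm" where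
  "conc (Abs a F ss t) u = subst t a u"

text \<open>
  \<open>inst \<theta> t\<close> replaces the parameters of \<open>t\<close> by their values in \<open>\<theta>\<close> and performs the suspended
  concretions.  Abstracted atoms are first renamed to new ones, so that no atom of \<open>\<theta>\<close> is captured.
\<close>

type_synonym ('s, 'f) pinst = "(param \<times> ('s, 'f) trm) list"

function inst :: "('s, 'f) pinst \<Rightarrow> ('s, 'f) trm \<Rightarrow> ('s, 'f) trm" where
  "inst \<theta> (At a) = At a"
| "inst \<theta> (Par X us) =
    (case map_of \<theta> X of
       None \<Rightarrow> Par X (map (inst \<theta>) us)
     | Some t \<Rightarrow> foldl conc t (map (inst \<theta>) us))"
| "inst \<theta> (Con f ts) = Con f (map (inst \<theta>) ts)"
| "inst \<theta> (Abs a F ss t) =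
    (let c = (SOME c. c \<noteq> a \<and> fresh c t \<and> (\<forall>(X, u) \<in> set \<theta>. fresh c u))
     in Abs c F (map (inst \<theta>) ss) (inst \<theta> (perm (transpose a c) t)))"
  by pat_completeness auto
termination
  by (relation "measure (\<lambda>(\<theta>, t). size t)")
     (auto simp: less_Suc_eq_le dest: size_list_estimation'[OF _ order_refl, where f = size])

function inst_srt :: "('s, 'f) pinst \<Rightarrow> ('s, 'f) srt \<Rightarrow> ('s, 'f) srt" where
  "inst_srt \<theta> (Data F ts) = Data F (map (inst \<theta>) ts)"
| "inst_srt \<theta> (SAbs a F ss g) =
    (let c = (SOME c. c \<noteq> a \<and> fresh_srt c g \<and> (\<forall>(X, u) \<in> set \<theta>. fresh c u))
     in SAbs c F (map (inst \<theta>) ss) (inst_srt \<theta> (perm_srt (transpose a c) g)))"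
  by pat_completeness auto
termination by (relation "measure (\<lambda>(\<theta>, g). size g)") auto


section \<open>Signatures and sorting\<close>

text \<open>
  \<open>sdecl S F = \<Delta>\<close> stands for the declaration of \<open>F : \<Delta> \<rightarrow> data\<close>, and \<open>tdecl S f = (\<Delta>, F, us)\<close> for
  that of \<open>f : \<Delta> \<rightarrow> F us\<close>.  All freshness contexts are empty and therefore omitted.
\<close>

type_synonym ('s, 'f) telescope = "(param \<times> ('s, 'f) srt) list"

record ('s, 'f) signat =
  sdecl :: "'s \<Rightarrow> ('s, 'f) telescope"
  tdecl :: "'f \<Rightarrow> ('s, 'f) telescope \<times> 's \<times> ('s, 'f) trm list"

text \<open>\<open>(a, F, ss)\<close> declares the atom \<open>a\<close> with the data sort \<open>F ss\<close>.  That the declared atoms are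
  distinct is not part of the type; it is preserved by the rules for \<open>sorting\<close> below.\<close>

type_synonym ('s, 'f) ctxt = "(atom \<times> 's \<times> ('s, 'f) trm list) list"

text \<open>
  \<open>sorted_args S \<Gamma> \<theta> \<Delta> ts\<close>: the terms \<open>ts\<close> have the sorts declared in \<open>\<Delta>\<close>, each instantiated on the
  preceding terms; \<open>\<theta>\<close> accumulates the instantiation.  Only ground terms are sorted, so there is no
  rule for parameters.
\<close>

inductive sorting :: "('s, 'f) signat \<Rightarrow> ('s, 'f) ctxt \<Rightarrow> ('s, 'f) trm \<Rightarrow> ('s, 'f) srt \<Rightarrow> bool"
  and sorted_args :: "('s, 'f) signat \<Rightarrow> ('s, 'f) ctxt \<Rightarrow> ('s, 'f) pinst \<Rightarrow> ('s, 'f) telescope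
      \<Rightarrow> ('s, 'f) trm list \<Rightarrow> bool"
  and wf_data :: "('s, 'f) signat \<Rightarrow> ('s, 'f) ctxt \<Rightarrow> 's \<Rightarrow> ('s, 'f) trm list \<Rightarrow> bool"
  for S :: "('s, 'f) signat"
where
  sorting_At: "(a, F, ss) \<in> set \<Gamma> \<Longrightarrow> sorting S \<Gamma> (At a) (Data F ss)"
| sorting_Con: "tdecl S f = (\<Delta>, F, us) \<Longrightarrow> sorted_args S \<Gamma> [] \<Delta> ts
    \<Longrightarrow> sorting S \<Gamma> (Con f ts) (Data F (map (inst (zip (map fst \<Delta>) ts)) us))"
| sorting_Abs: "wf_data S \<Gamma> F ss
    \<Longrightarrow> sorting S (\<Gamma> @ [(b, F, ss)]) (perm (transpose a b) t) (perm_srt (transpose a b) g)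
    \<Longrightarrow> b \<notin> fst ` set \<Gamma> \<Longrightarrow> fresh b t \<Longrightarrow> fresh_srt b g
    \<Longrightarrow> sorting S \<Gamma> (Abs a F ss t) (SAbs a F ss g)"
| sorting_conv: "sorting S \<Gamma> t g \<Longrightarrow> aeq_srt g g' \<Longrightarrow> sorting S \<Gamma> t g'"
| sorted_args_Nil: "sorted_args S \<Gamma> \<theta> [] []"
| sorted_args_Cons: "sorting S \<Gamma> t (inst_srt \<theta> g) \<Longrightarrow> sorted_args S \<Gamma> (\<theta> @ [(X, t)]) \<Delta> ts
    \<Longrightarrow> sorted_args S \<Gamma> \<theta> ((X, g) # \<Delta>) (t # ts)"
| wf_data: "sorted_args S \<Gamma> [] (sdecl S F) ss \<Longrightarrow> wf_data S \<Gamma> F ss"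


section \<open>The shallow encoding of the lambda calculus\<close>

datatype lsort = LamS | Contr

datatype lcon = AppC | LamC | BetaC

abbreviation \<Lambda> :: "(lsort, lcon) srt" where "\<Lambda> \<equiv> Data LamS []"

text \<open>
  In the abstraction sorts any abstracted atom will do, since it is not used.  \<open>LamS\<close> is the sort
  of lambda terms and \<open>Contr\<close> that of contractions (a triangle in infix notation).
\<close>

fun lam_sdecl :: "lsort \<Rightarrow> (lsort, lcon) telescope" where
  "lam_sdecl LamS = []"
| "lam_sdecl Contr = [(''_1'', \<Lambda>), (''_2'', \<Lambda>)]"

fun lam_tdecl :: "lcon \<Rightarrow> (lsort, lcon) telescope \<times> lsort \<times> (lsort, lcon) trm list" where
  "lam_tdecl AppC = ([(''_1'', \<Lambda>), (''_2'', \<Lambda>)], LamS, [])"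
| "lam_tdecl LamC = ([(''_1'', SAbs (Atom 0) LamS [] \<Lambda>)], LamS, [])"
| "lam_tdecl BetaC =
    ([(''B'', SAbs (Atom 0) LamS [] \<Lambda>), (''N'', \<Lambda>)], Contr,
     [Con AppC [Con LamC [Par ''B'' []], Par ''N'' []], Par ''B'' [Par ''N'' []]])"

definition lam_sig :: "(lsort, lcon) signat" where
  "lam_sig = \<lparr>sdecl = lam_sdecl, tdecl = lam_tdecl\<rparr>"

text \<open>The argument \<open>a\<close> sends the index of a variable to the atom that encodes the variable; it is
  meant to be injective.\<close>

primrec enc :: "(nat \<Rightarrow> atom) \<Rightarrow> lam \<Rightarrow> (lsort, lcon) trm" where
  "enc a (Var x) = At (a x)"
| "enc a (Ap r s) = Con AppC [enc a r, enc a s]"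
| "enc a (Lm x r) = Con LamC [Abs (a x) LamS [] (enc a r)]"

end

theory Submission
  imports Defs
begin

text \<open>
  Renaming atoms in an encoding amounts to changing the assignment of atoms to variables.  Since the
  abstraction rule only renames the bound atom, the sorting of encodings follows by induction on the
  lambda term with an arbitrary injective assignment.  The suspended concretions in the sort of
  \<open>BetaC\<close> reduce to the ones in the claim, and as the context declares the free variables of \<open>s\<close>
  instead of those of the redex, it remains to see that alpha-conversion preserves free variables.
\<close>

lemma finite_FV [simp]: "finite (FV s)"
  by (induction s) auto

text \<open>Injectivity makes the image under \<open>p\<close> commute with the removal of the bound
  variable.\<close>

lemma FV_lperm: "inj p \<Longrightarrow> FV (lperm p s) = p ` FV s"
  by (induction s) (auto simp: image_Un inj_eq image_set_diff)

text \<open>Needed for the \<open>rename\<close> rule in \<open>FV_lalpha\<close>. Only the case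
  where a binder is renamed takes work; there the new variable \<open>z\<close> merely takes the
  place of \<open>y\<close>.\<close>

lemma FV_lsubst: "FV (lsubst s x r) = (if x \<in> FV s then FV s - {x} \<union> FV r else FV s)"
proof (induction s x r rule: lsubst.induct)
  case (3 y s x r)
  define z where "z = (SOME z. z \<noteq> x \<and> z \<noteq> y \<and> z \<notin> FV s \<and> z \<notin> FV r)"
  have "\<exists>z. z \<notin> {x, y} \<union> FV s \<union> FV r"
    by (rule ex_new_if_finite) simp_all
  then have "\<exists>z. z \<noteq> x \<and> z \<noteq> y \<and> z \<notin> FV s \<and> z \<notin> FV r"
    by blast
  from someI_ex [OF this] have z: "z \<noteq> x" "z \<noteq> y" "z \<notin> FV s" "z \<notin> FV r"
    by (simp_all flip: z_def)
  consider "y = x" | "y \<noteq> x" "y \<notin> FV r" | "y \<noteq> x" "y \<in> FV r"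
    by blast
  then show ?case
  proof cases
    case 2
    with 3(1) show ?thesis by auto
  next
    case 3
    have perm: "FV (lperm (transpose y z) s) = transpose y z ` FV s"
      by (rule FV_lperm) simp
    \<comment> \<open>As \<open>z\<close> is not in \<open>FV s\<close>, the swapping fixes
      \<open>FV s\<close> apart from sending \<open>y\<close> to \<open>z\<close>, and
      \<open>z\<close> is removed.\<close>
    have image: "transpose y z ` FV s - {z} = FV s - {y}"
    proof (intro equalityI subsetI)
      fix w assume "w \<in> transpose y z ` FV s - {z}"
      then show "w \<in> FV s - {y}"
        using z by (auto simp: transpose_def split: if_splits)
    next
      fix w assume w: "w \<in> FV s - {y}"
      with z have "w \<noteq> z" by blast
      with w have "w = transpose y z w" by simp
      with w \<open>w \<noteq> z\<close> show "w \<in> transpose y z ` FV s - {z}" by blast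
    qed
    have mem: "x \<in> transpose y z ` FV s \<longleftrightarrow> x \<in> FV s"
    proof -
      have "x \<in> transpose y z ` FV s \<longleftrightarrow> x \<in> transpose y z ` FV s - {z}"
        using z(1) by simp
      also have "\<dots> \<longleftrightarrow> x \<in> FV s"
        unfolding image using \<open>y \<noteq> x\<close> by simp
      finally show ?thesis .
    qed
    have IH: "FV (lsubst (lperm (transpose y z) s) x r) =
        (if x \<in> FV s then transpose y z ` FV s - {x} \<union> FV r else transpose y z ` FV s)"
      using "3.IH"(2) [OF 3(1) _ z_def] 3(2) by (simp add: perm mem)
    have "lsubst (Lm y s) x r = Lm z (lsubst (lperm (transpose y z) s) x r)"
      using 3 by (simp add: z_def Let_def)
    then have "FV (lsubst (Lm y s) x r) =
        (if x \<in> FV s then transpose y z ` FV s - {z} - {x} \<union> FV r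
         else transpose y z ` FV s - {z})"
      using IH z(4) by auto
    then show ?thesis
      unfolding image using 3 by simp
  qed simp
qed auto

text \<open>For \<open>rename\<close>, the condition that \<open>y\<close> is not in
  \<open>FV s\<close> ensures that binding \<open>y\<close> removes only what was substituted for
  \<open>x\<close>.\<close>

lemma FV_lalpha: "s \<equiv>\<^sub>\<alpha> t \<Longrightarrow> FV s = FV t"
  by (induction rule: lalpha.induct) (auto simp: FV_lsubst)

lemma perm_enc: "perm p (enc a r) = enc (p \<circ> a) r"
  by (induction r) simp_all

text \<open>Supplies the new atom that \<open>sorting_Abs\<close> asks for.\<close>

lemma finite_not_fresh_enc: "finite {b. \<not> fresh b (enc a r)}"
proof (induction r)
  case (Ap r s)
  have "{b. \<not> fresh b (enc a (Ap r s))} =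
      {b. \<not> fresh b (enc a r)} \<union> {b. \<not> fresh b (enc a s)}"
    by auto
  with Ap show ?case by (metis finite_Un)
next
  case (Lm x r)
  then show ?case
    by (rule finite_subset [rotated]) auto
qed simp

lemma infinite_atoms: "infinite (UNIV :: atom set)"
  using finite_imageD [of Atom UNIV] finite_subset [of "range Atom" UNIV]
  by (auto simp: inj_def)

lemma aeq_srt_SAbs_Lambda: "aeq_srt (SAbs b LamS [] \<Lambda>) (SAbs c LamS [] \<Lambda>)"
  by (cases "b = c") (auto intro!: aeq_srt.intros)

text \<open>\<open>inst_srt\<close> picks its bound atom by \<open>SOME\<close>. Which atom it picks
  is irrelevant: no atom occurs in \<Lambda>, so all these abstraction sorts are
  alpha-equivalent.\<close>

lemma sorting_inst_SAbs_Lambda: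
  assumes "sorting lam_sig \<Gamma> t (SAbs b LamS [] \<Lambda>)"
  shows "sorting lam_sig \<Gamma> t (inst_srt \<theta> (SAbs c LamS [] \<Lambda>))"
  using sorting_conv [OF assms aeq_srt_SAbs_Lambda] by (simp add: Let_def)

text \<open>The sorting of the body is a premise so that the lemma serves both inside the induction
  for \<open>sorting_enc\<close>, with the induction hypothesis, and after it.\<close>

lemma sorting_Abs_Lambda:
  assumes "inj a"
    and vars: "\<And>j. j \<in> FV r - {x} \<Longrightarrow> (a j, LamS, []) \<in> set \<Gamma>"
    and body: "\<And>a' \<Gamma>'. inj a' \<Longrightarrow> (\<And>j. j \<in> FV r \<Longrightarrow> (a' j, LamS, []) \<in> set \<Gamma>')
      \<Longrightarrow> sorting lam_sig \<Gamma>' (enc a' r) \<Lambda>"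
  shows "sorting lam_sig \<Gamma> (Abs (a x) LamS [] (enc a r)) (SAbs (a x) LamS [] \<Lambda>)"
proof -
  have "\<exists>b. b \<notin> fst ` set \<Gamma> \<union> {b. \<not> fresh b (enc a r)}"
    by (rule ex_new_if_finite [OF infinite_atoms]) (simp add: finite_not_fresh_enc)
  then obtain b where b: "b \<notin> fst ` set \<Gamma>" "fresh b (enc a r)"
    by blast
  \<comment> \<open>By \<open>perm_enc\<close> this is the swapped body in
    \<open>sorting_Abs\<close>; the new assignment sends \<open>x\<close> to
    \<open>b\<close>.\<close>
  have "sorting lam_sig (\<Gamma> @ [(b, LamS, [])]) (enc (transpose (a x) b \<circ> a) r) \<Lambda>"
  proof (rule body)
    show "inj (transpose (a x) b \<circ> a)"
      using \<open>inj a\<close> by (intro inj_compose) simp_all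
    fix j assume j: "j \<in> FV r"
    show "((transpose (a x) b \<circ> a) j, LamS, []) \<in> set (\<Gamma> @ [(b, LamS, [])])"
    proof (cases "j = x")
      case False
      then have "(a j, LamS, []) \<in> set \<Gamma>" and "a j \<noteq> a x"
        using vars j \<open>inj a\<close> by (auto dest: injD)
      \<comment> \<open>The context declares \<open>a j\<close> but not \<open>b\<close>, so the
        swapping leaves \<open>a j\<close> alone.\<close>
      moreover from this b have "a j \<noteq> b" by force
      ultimately show ?thesis by simp
    qed simp
  qed
  moreover have "wf_data lam_sig \<Gamma> LamS []"
    by (rule wf_data) (simp add: lam_sig_def sorted_args_Nil)
  ultimately show ?thesis
    using b by (intro sorting_Abs [where b = b]) (simp_all add: perm_enc)
qed

lemma sorting_enc:
  assumes "inj a" and "\<And>j. j \<in> FV r \<Longrightarrow> (a j, LamS, []) \<in> set \<Gamma>"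
  shows "sorting lam_sig \<Gamma> (enc a r) \<Lambda>"
  using assms
proof (induction r arbitrary: a \<Gamma>)
  case (Var x)
  then show ?case by (auto intro: sorting_At)
next
  case (Ap r s)
  have "sorting lam_sig \<Gamma> (enc a r) \<Lambda>" "sorting lam_sig \<Gamma> (enc a s) \<Lambda>"
    using Ap by auto
  then have "sorted_args lam_sig \<Gamma> [] [(''_1'', \<Lambda>), (''_2'', \<Lambda>)] [enc a r, enc a s]"
    by (intro sorted_args_Cons sorted_args_Nil) simp_all
  from sorting_Con [OF _ this, of AppC LamS "[]"] show ?case
    by (simp add: lam_sig_def)
next
  case (Lm x r)
  have "sorting lam_sig \<Gamma> (Abs (a x) LamS [] (enc a r)) (SAbs (a x) LamS [] \<Lambda>)"
    by (rule sorting_Abs_Lambda) (use Lm in auto)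
  then have "sorted_args lam_sig \<Gamma> [] [(''_1'', SAbs (Atom 0) LamS [] \<Lambda>)]
      [Abs (a x) LamS [] (enc a r)]"
    by (intro sorted_args_Cons sorted_args_Nil sorting_inst_SAbs_Lambda)
  from sorting_Con [OF _ this, of LamC LamS "[]"] show ?case
    by (simp add: lam_sig_def)
qed

theorem lemma10:
  fixes a :: "nat \<Rightarrow> atom" and i :: nat and s t s1 s2 :: lam
    and \<Gamma> :: "(lsort, lcon) ctxt"
  assumes "inj a"
    and "s \<equiv>\<^sub>\<alpha> Ap (Lm i s1) s2"
    and "t \<equiv>\<^sub>\<alpha> lsubst s1 i s2"
    and "distinct (map fst \<Gamma>)"
    and "set \<Gamma> = {(a j, LamS, []) | j. j \<in> FV s}"
  shows "sorting lam_sig \<Gamma>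
    (Con BetaC [Abs (a i) LamS [] (enc a s1), enc a s2])
    (Data Contr
      [Con AppC [Con LamC [Abs (a i) LamS [] (enc a s1)], enc a s2],
       conc (Abs (a i) LamS [] (enc a s1)) (enc a s2)])"
proof -
  let ?B = "Abs (a i) LamS [] (enc a s1)"
  let ?us = "[Con AppC [Con LamC [Par ''B'' []], Par ''N'' []], Par ''B'' [Par ''N'' []]]"
  have vars: "(a j, LamS, []) \<in> set \<Gamma>" if "j \<in> FV s1 - {i} \<union> FV s2" for j
    using that assms(5) FV_lalpha [OF assms(2)] by auto
  have "sorting lam_sig \<Gamma> ?B (SAbs (a i) LamS [] \<Lambda>)"
    \<comment> \<open>The premise on the body is \<open>sorting_enc\<close> for
      \<open>s1\<close>.\<close>
    using \<open>inj a\<close> by (rule sorting_Abs_Lambda) (auto intro: vars sorting_enc)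
  moreover have "sorting lam_sig \<Gamma> (enc a s2) \<Lambda>"
    using \<open>inj a\<close> by (rule sorting_enc) (simp add: vars)
  ultimately have "sorted_args lam_sig \<Gamma> []
      [(''B'', SAbs (Atom 0) LamS [] \<Lambda>), (''N'', \<Lambda>)] [?B, enc a s2]"
    by (intro sorted_args_Cons sorted_args_Nil sorting_inst_SAbs_Lambda) simp_all
  \<comment> \<open>Instantiating \<open>?us\<close> turns \<open>Par ''B'' [Par ''N'' []]\<close>
    into \<open>conc ?B (enc a s2)\<close>.\<close>
  from sorting_Con [OF _ this, of BetaC Contr ?us] show ?thesis
    by (simp add: lam_sig_def)
qed

end
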